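(* Let $\Omega$ be a bounded convex domain of $\mathbb R^N$ with smooth boundary and $0\in\operatorname{Int}\Omega$. Let $a\in C^2(\overline\Omega)$ be nonnegative with $a(x)>0$ for $x\in\Omega$, and let $f:[0,+\infty)\to[0,+\infty)$ be $C^2$ and increasing, with $f(s)>0$ for $s>0$. Put $f_0=\lim_{s\to0^+}f(s)/s^N$ and $f_\infty=\lim_{s\to+\infty}f(s)/s^N$. Consider, for $\lambda>0$, the problem $$\det(D^2u)=\lambda^Na(x)f(-u)\ \text{ in }\Omega,\qquad u=0\ \text{ on }\partial\Omega. \quad (P_\lambda)$$ (a) If $f_0\in(0,+\infty)$ and $f_\infty\in(0,+\infty)$, then there exist $\mu_2>0$ and $\mu_3>0$ such that $(P_\lambda)$ has no convex solution for all $\lambda\in(0,\mu_2)\cup(\mu_3,+\infty)$. (b) If $f_0\in(0,+\infty)$ and $f_\infty=0$, then there exists $\mu_4>0$ such that $(P_\lambda)$ has no convex solution for all $\lambda\in(0,\mu_4)$. (c) If $f_0\in(0,+\infty)$ and $f_\infty=+\infty$, then there exists $\mu_5>0$ such that $(P_\lambda)$ has no convex solution for all $\lambda\in(\mu_5,+\infty)$. (d) If $f_0=0$ and $f_\infty\in(0,+\infty)$, then there exists $\mu_6>0$ such that $(P_\lambda)$ has no convex solution for all $\lambda\in(0,\mu_6)$. (e) If $f_0=0$ and $f_\infty=0$, then there exists $\mu_7>0$ such that $(P_\lambda)$ has no convex solution for all $\lambda\in(0,\mu_7)$. (f) If $f_0=+\infty$ and $f_\infty\in(0,+\infty)$, then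 there exists $\mu_8>0$ such that $(P_\lambda)$ has no convex solution for all $\lambda\in(\mu_8,+\infty)$. (g) If $f_0=+\infty$ and $f_\infty=+\infty$, then there exists $\mu_9>0$ such that $(P_\lambda)$ has no convex solution for all $\lambda\in(\mu_9,+\infty)$.
   Context: $D^2u$ is the Hessian matrix of $u$. As in the paper, a convex solution means a nontrivial convex function solving the problem (with $D^2u$ positive definite where the equation is elliptic); such a solution is negative and strictly convex in $\Omega$. *)

theory Defs
  imports "HOL-Analysis.Analysis"
begin

definition partial_derivative :: "'n::finite \<Rightarrow> (real ^ 'n \<Rightarrow> real) \<Rightarrow> real ^ 'n \<Rightarrow> real" where
  "partial_derivative i u x = deriv (\<lambda>t. u (x + t *\<^sub>R axis i 1)) 0"

definition hessian :: "(real ^ 'n::finite \<Rightarrow> real) \<Rightarrow> real ^ 'n \<Rightarrow> real ^ 'n ^ 'n" where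
  "hessian u x = (\<chi> i j. partial_derivative j (partial_derivative i u) x)"

(* C^k on an open set S: all iterated partial derivatives up to order k exist and are
   continuous on S. *)
primrec Ck_on :: "nat \<Rightarrow> (real ^ 'n::finite) set \<Rightarrow> (real ^ 'n \<Rightarrow> real) \<Rightarrow> bool" where
  "Ck_on 0 S u \<longleftrightarrow> continuous_on S u"
| "Ck_on (Suc k) S u \<longleftrightarrow> continuous_on S u \<and>
     (\<forall>i. (\<forall>x\<in>S. (\<lambda>t. u (x + t *\<^sub>R axis i 1)) field_differentiable (at 0)) \<and>
          Ck_on k S (partial_derivative i u))"

definition continuously_extends :: "(real ^ 'n::finite) set \<Rightarrow> (real ^ 'n \<Rightarrow> real) \<Rightarrow> bool" where
  "continuously_extends S u \<longleftrightarrow>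
     (\<exists>g. continuous_on (closure S) g \<and> (\<forall>x\<in>S. g x = u x))"

primrec Ck_extends :: "nat \<Rightarrow> (real ^ 'n::finite) set \<Rightarrow> (real ^ 'n \<Rightarrow> real) \<Rightarrow> bool" where
  "Ck_extends 0 S u \<longleftrightarrow> continuously_extends S u"
| "Ck_extends (Suc k) S u \<longleftrightarrow> continuously_extends S u \<and>
     (\<forall>i. (\<forall>x\<in>S. (\<lambda>t. u (x + t *\<^sub>R axis i 1)) field_differentiable (at 0)) \<and>
          Ck_extends k S (partial_derivative i u))"

(* C^k(closure S), S open: all partial derivatives in S up to order k extend continuously to
   closure S, where at order 0 the extension is u itself. *)
definition Ck_on_closure :: "nat \<Rightarrow> (real ^ 'n::finite) set \<Rightarrow> (real ^ 'n \<Rightarrow> real) \<Rightarrow> bool" where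
  "Ck_on_closure k S u \<longleftrightarrow> continuous_on (closure S) u \<and> Ck_extends k S u"

(* C^2 on [0,\<infinity>), with one-sided derivatives at 0. *)
definition C2_on_halfline :: "(real \<Rightarrow> real) \<Rightarrow> bool" where
  "C2_on_halfline f \<longleftrightarrow>
     (\<exists>f' f''. (\<forall>s\<ge>0. (f has_real_derivative f' s) (at s within {0..})) \<and>
               (\<forall>s\<ge>0. (f' has_real_derivative f'' s) (at s within {0..})) \<and>
               continuous_on {0..} f'')"

(* C^\<infinity> boundary: near each boundary point S is the sublevel set {\<rho> < 0} of a C^\<infinity> function
   \<rho> with nonvanishing gradient. The frontier of S is then locally {\<rho> = 0}, with S on one side. *)
definition smooth_boundary :: "(real ^ 'n::finite) set \<Rightarrow> bool" where
  "smooth_boundary S \<longleftrightarrow>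
     (\<forall>p\<in>frontier S. \<exists>U \<rho>. open U \<and> p \<in> U \<and> (\<forall>k. Ck_on k U \<rho>) \<and>
        (\<forall>x\<in>U. \<exists>i. partial_derivative i \<rho> x \<noteq> 0) \<and>
        S \<inter> U = {x \<in> U. \<rho> x < 0})"

(* Nontrivial convex u in C^2(\<Omega>) and C(closure \<Omega>) solving det D^2u = lam^N a f(-u) classically. Convexity and the
   boundary condition give u \<le> 0, so only the values of f on [0,\<infinity>) matter. Positive definiteness
   of the Hessian where the right-hand side is positive is automatic (convexity and det > 0). *)
definition convex_solution ::
  "(real ^ 'n::finite) set \<Rightarrow> (real ^ 'n \<Rightarrow> real) \<Rightarrow> (real \<Rightarrow> real) \<Rightarrow> real \<Rightarrow> (real ^ 'n \<Rightarrow> real) \<Rightarrow> bool"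
where
  "convex_solution \<Omega> a f lam u \<longleftrightarrow>
     Ck_on 2 \<Omega> u \<and> continuous_on (closure \<Omega>) u \<and> convex_on \<Omega> u \<and> (\<exists>x\<in>\<Omega>. u x \<noteq> 0) \<and>
     (\<forall>x\<in>\<Omega>. det (hessian u x) = lam ^ CARD('n) * a x * f (- u x)) \<and>
     (\<forall>x\<in>frontier \<Omega>. u x = 0)"

end

theory Submission
  imports Defs
begin

text \<open>
  The argument compares a solution \<open>u\<close> of depth \<open>M = - min u > 0\<close> with paraboloids of opening
  \<open>k\<close> proportional to \<open>\<lambda> M\<close>.

  If \<open>f s \<le> C s\<^sup>N\<close>, then \<open>det D\<^sup>2u\<close> is at most a multiple of \<open>(\<lambda> M)\<^sup>N\<close>. At an interior minimum of
  \<open>u - k/2 |x|\<^sup>2\<close> one would have \<open>D\<^sup>2u \<ge> k I\<close>, which forces a larger determinant; so the minimum is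
  attained on the boundary. Hence \<open>M \<le> k R\<^sup>2 / 2\<close>, and dividing by \<open>M\<close> bounds \<open>\<lambda>\<close> from below.

  If \<open>f s \<ge> c s\<^sup>N\<close>, convexity gives \<open>- u \<ge> s M\<close> on a ball of radius \<open>r\<close> compactly contained in the
  domain, so \<open>det D\<^sup>2u\<close> is there at least a multiple of \<open>(\<lambda> M)\<^sup>N\<close>. At an interior maximum of
  \<open>u - k/2 |x|\<^sup>2\<close> one would have \<open>0 \<le> D\<^sup>2u \<le> k I\<close>, which forces a smaller determinant; so
  \<open>u 0 \<le> - k r\<^sup>2 / 2\<close>, and dividing by \<open>M\<close> bounds \<open>\<lambda>\<close> from above.

  Constants are irrelevant, so determinants are only estimated up to the factor \<open>N!\<close> from the
  permutation expansion, without diagonalising.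
\<close>

section \<open>Functions with continuous partial derivatives\<close>

text \<open>\<open>partial_derivative\<close> is a derivative at parameter 0; translating the base
  point turns it into a derivative at every parameter of a coordinate line.\<close>

lemma partial_derivative_DERIV:
  fixes u :: "real ^ 'n::finite \<Rightarrow> real"
  assumes "Ck_on (Suc k) S u" and "x + t *\<^sub>R axis i 1 \<in> S"
  shows "((\<lambda>t. u (x + t *\<^sub>R axis i 1)) has_real_derivative
           partial_derivative i u (x + t *\<^sub>R axis i 1)) (at t)"
proof -
  let ?y = "x + t *\<^sub>R axis i 1"
  have "(\<lambda>s. u (?y + s *\<^sub>R axis i 1)) field_differentiable at 0"
    using assms by auto
  then have "((\<lambda>s. u (?y + s *\<^sub>R axis i 1)) has_real_derivative partial_derivative i u ?y) (at 0)"
    unfolding partial_derivative_def by (simp add: DERIV_deriv_iff_field_differentiable)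
  then have "((\<lambda>s. u (x + (s + t) *\<^sub>R axis i 1)) has_real_derivative partial_derivative i u ?y) (at 0)"
    by (simp add: algebra_simps)
  then show ?thesis
    using DERIV_shift[of "\<lambda>s. u (x + s *\<^sub>R axis i 1)" "partial_derivative i u ?y" 0 t] by simp
qed

text \<open>Parametrising the segment by \<theta> in [0, 1] treats both signs of \<open>h\<close>,
  and \<open>h = 0\<close>, at once.\<close>

lemma partial_derivative_MVT:
  fixes u :: "real ^ 'n::finite \<Rightarrow> real"
  assumes "Ck_on (Suc k) S u" and "\<And>\<theta>. 0 \<le> \<theta> \<Longrightarrow> \<theta> \<le> 1 \<Longrightarrow> x + (\<theta> * h) *\<^sub>R axis i 1 \<in> S"
  obtains \<theta> where "0 < \<theta>" "\<theta> < 1"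
    "u (x + h *\<^sub>R axis i 1) - u x = h * partial_derivative i u (x + (\<theta> * h) *\<^sub>R axis i 1)"
proof -
  have "((\<lambda>\<theta>. u (x + (\<theta> * h) *\<^sub>R axis i 1)) has_real_derivative
          partial_derivative i u (x + (\<theta> * h) *\<^sub>R axis i 1) * h) (at \<theta>)"
    if "0 \<le> \<theta>" "\<theta> \<le> 1" for \<theta>
    by (rule DERIV_chain2[where f = "\<lambda>s. u (x + s *\<^sub>R axis i 1)" and g = "\<lambda>\<theta>. \<theta> * h"])
       (use assms(2)[OF that] in \<open>auto intro!: partial_derivative_DERIV[OF assms(1)] derivative_eq_intros\<close>)
  from MVT2[OF zero_less_one this] obtain \<theta> where "0 < \<theta>" "\<theta> < 1"
    "u (x + (1 * h) *\<^sub>R axis i 1) - u (x + (0 * h) *\<^sub>R axis i 1)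
       = (1 - 0) * (partial_derivative i u (x + (\<theta> * h) *\<^sub>R axis i 1) * h)"
    by blast
  then show thesis
    using that by (simp add: mult.commute)
qed

text \<open>\<open>Ck_on\<close> speaks of coordinate directions, while the contact and convexity
  arguments run along arbitrary lines. The way from \<open>x\<close> to \<open>x + h\<close> is
  walked one coordinate at a time, with the mean value theorem on each leg and continuity of the
  partial derivatives at \<open>x\<close>.\<close>

lemma C1_imp_has_derivative:
  fixes u :: "real ^ 'n::finite \<Rightarrow> real"
  assumes u: "Ck_on (Suc 0) S u" and "open S" and "x \<in> S"
  shows "(u has_derivative (\<lambda>h. \<Sum>i\<in>UNIV. h $ i * partial_derivative i u x)) (at x)"
proof -
  \<comment> \<open>\<open>P I h\<close> keeps the coordinates of \<open>h\<close> with index in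
    \<open>I\<close>; adding one index to \<open>I\<close> is one leg of the walk.\<close>
  define P where "P I h = (\<chi> i. if i \<in> I then h $ i else 0)" for I and h :: "real ^ 'n"
  obtain r where r: "r > 0" "ball x r \<subseteq> S"
    using assms(2,3) open_contains_ball by blast
  have main: "\<exists>\<delta>>0. \<forall>h. norm h < \<delta> \<longrightarrow>
      \<bar>u (x + P I h) - u x - (\<Sum>i\<in>I. h $ i * partial_derivative i u x)\<bar> \<le> e * norm h"
    if "finite I" "e > 0" for I e
    using that
  proof (induction I arbitrary: e rule: finite_induct)
    case empty
    have "P {} h = 0" for h
      by (simp add: P_def vec_eq_iff)
    with empty show ?case
      by (auto intro!: exI[of _ 1])
  next
    case (insert j I)
    obtain \<delta>1 where \<delta>1: "\<delta>1 > 0" "\<And>h. norm h < \<delta>1 \<Longrightarrow>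
        \<bar>u (x + P I h) - u x - (\<Sum>i\<in>I. h $ i * partial_derivative i u x)\<bar> \<le> e / 2 * norm h"
      using insert.IH[of "e / 2"] insert.prems by auto
    have "continuous_on S (partial_derivative j u)"
      using u by simp
    then have "isCont (partial_derivative j u) x"
      using assms(2,3) continuous_on_eq_continuous_at by blast
    then obtain \<delta>2 where \<delta>2: "\<delta>2 > 0" "\<And>y. dist y x < \<delta>2 \<Longrightarrow>
        dist (partial_derivative j u y) (partial_derivative j u x) < e / 2"
      unfolding continuous_at_eps_delta using insert.prems half_gt_zero by metis
    show ?case
    proof (intro exI[of _ "min \<delta>1 (min \<delta>2 r)"] conjI allI impI)
      show "min \<delta>1 (min \<delta>2 r) > 0"
        using \<delta>1(1) \<delta>2(1) r(1) by simp
      fix h :: "real ^ 'n"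
      assume h: "norm h < min \<delta>1 (min \<delta>2 r)"
      \<comment> \<open>Truncating \<open>h\<close> and shortening one coordinate cannot increase
        the norm, so the whole leg stays where both estimates hold.\<close>
      have near: "dist (x + P I h + (\<theta> * h $ j) *\<^sub>R axis j 1) x \<le> norm h"
        if "0 \<le> \<theta>" "\<theta> \<le> 1" for \<theta>
      proof -
        have "norm (P I h + (\<theta> * h $ j) *\<^sub>R axis j 1) \<le> norm h"
          using that insert.hyps
          by (intro norm_le_componentwise_cart)
             (auto simp: P_def axis_def abs_mult mult_left_le_one_le)
        then show ?thesis
          by (simp add: dist_norm add.assoc)
      qed
      have "x + P I h + (\<theta> * h $ j) *\<^sub>R axis j 1 \<in> S" if "0 \<le> \<theta>" "\<theta> \<le> 1" for \<theta>
        using near[OF that] h r(2) by (auto simp: dist_commute subset_eq)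
      from partial_derivative_MVT[OF u this] obtain \<theta> where \<theta>: "0 < \<theta>" "\<theta> < 1"
        "u (x + P I h + h $ j *\<^sub>R axis j 1) - u (x + P I h)
          = h $ j * partial_derivative j u (x + P I h + (\<theta> * h $ j) *\<^sub>R axis j 1)"
        by metis
      let ?z = "x + P I h + (\<theta> * h $ j) *\<^sub>R axis j 1"
      have "P (insert j I) h = P I h + h $ j *\<^sub>R axis j 1"
        using insert.hyps by (auto simp: P_def vec_eq_iff axis_def)
      then have eq: "u (x + P (insert j I) h) = u (x + P I h) + h $ j * partial_derivative j u ?z"
        using \<theta>(3) by (simp add: add.assoc)
      have "\<bar>partial_derivative j u ?z - partial_derivative j u x\<bar> \<le> e / 2"
        using \<delta>2(2)[of ?z] near[of \<theta>] \<theta> h by (auto simp: dist_real_def)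
      then have "\<bar>h $ j * (partial_derivative j u ?z - partial_derivative j u x)\<bar> \<le> norm h * (e / 2)"
        unfolding abs_mult by (intro mult_mono component_le_norm_cart) auto
      with \<delta>1(2)[of h] h
      show "\<bar>u (x + P (insert j I) h) - u x
              - (\<Sum>i\<in>insert j I. h $ i * partial_derivative i u x)\<bar> \<le> e * norm h"
        using insert.hyps unfolding eq by (simp add: algebra_simps) argo
    qed
  qed
  have "P UNIV h = h" for h
    by (simp add: P_def vec_eq_iff)
  then have *: "\<exists>\<delta>>0. \<forall>h. norm h < \<delta> \<longrightarrow>
      \<bar>u (x + h) - u x - (\<Sum>i\<in>UNIV. h $ i * partial_derivative i u x)\<bar> \<le> e * norm h"
    if "e > 0" for e
    using main[of UNIV e] that by simp
  show ?thesis
    unfolding has_derivative_at_alt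
  proof (intro conjI allI impI)
    have "linear (\<lambda>h. \<Sum>i\<in>UNIV. h $ i * partial_derivative i u x)"
      by (intro linearI) (simp_all add: algebra_simps sum.distrib sum_distrib_left)
    then show "bounded_linear (\<lambda>h. \<Sum>i\<in>UNIV. h $ i * partial_derivative i u x)"
      by (simp add: linear_conv_bounded_linear)
    fix e :: real
    assume "e > 0"
    from *[OF this] obtain \<delta> where \<delta>: "\<delta> > 0" "\<And>h. norm h < \<delta> \<Longrightarrow>
      \<bar>u (x + h) - u x - (\<Sum>i\<in>UNIV. h $ i * partial_derivative i u x)\<bar> \<le> e * norm h"
      by blast
    show "\<exists>d>0. \<forall>y. norm (y - x) < d \<longrightarrow>
        norm (u y - u x - (\<Sum>i\<in>UNIV. (y - x) $ i * partial_derivative i u x)) \<le> e * norm (y - x)"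
      using \<delta>(1) \<delta>(2)[of "y - x" for y] by (intro exI[of _ \<delta>]) auto
  qed
qed

lemma C1_directional_DERIV:
  fixes u :: "real ^ 'n::finite \<Rightarrow> real"
  assumes "Ck_on (Suc 0) S u" and "open S" and "x + t *\<^sub>R h \<in> S"
  shows "((\<lambda>t. u (x + t *\<^sub>R h)) has_real_derivative
           (\<Sum>i\<in>UNIV. h $ i * partial_derivative i u (x + t *\<^sub>R h))) (at t)"
proof -
  have "((\<lambda>t. x + t *\<^sub>R h) has_derivative (\<lambda>s. s *\<^sub>R h)) (at t)"
    by (auto intro!: derivative_eq_intros)
  from has_derivative_compose[OF this C1_imp_has_derivative[OF assms]]
  have "((\<lambda>t. u (x + t *\<^sub>R h)) has_derivative
      (\<lambda>s. \<Sum>i\<in>UNIV. (s *\<^sub>R h) $ i * partial_derivative i u (x + t *\<^sub>R h))) (at t)" .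
  moreover have "(\<lambda>s. \<Sum>i\<in>UNIV. (s *\<^sub>R h) $ i * partial_derivative i u (x + t *\<^sub>R h))
      = (*) (\<Sum>i\<in>UNIV. h $ i * partial_derivative i u (x + t *\<^sub>R h))"
    by (auto simp: fun_eq_iff sum_distrib_right intro!: sum.cong)
  ultimately show ?thesis
    by (simp only: has_field_derivative_def)
qed

text \<open>Row \<open>i\<close> of the Hessian is the gradient of the i-th partial derivative, so
  the first-order directional derivative applied to each partial derivative yields the quadratic
  form.\<close>

lemma hessian_directional_DERIV:
  fixes u :: "real ^ 'n::finite \<Rightarrow> real"
  assumes "Ck_on 2 S u" and "open S" and "x \<in> S"
  shows "((\<lambda>t. \<Sum>i\<in>UNIV. h $ i * partial_derivative i u (x + t *\<^sub>R h)) has_real_derivative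
           h \<bullet> (hessian u x *v h)) (at 0)"
proof -
  have "((\<lambda>t. partial_derivative i u (x + t *\<^sub>R h)) has_real_derivative (hessian u x *v h) $ i) (at 0)" for i
  proof -
    have "Ck_on (Suc 0) S (partial_derivative i u)"
      using assms(1) by (simp add: numeral_2_eq_2)
    from C1_directional_DERIV[OF this assms(2), of x 0 h] assms(3) show ?thesis
      by (simp add: hessian_def matrix_vector_mult_def mult.commute)
  qed
  then show ?thesis
    unfolding inner_vec_def inner_real_def
    by (intro DERIV_sum DERIV_cmult)
qed

text \<open>Schwarz's theorem. It serves the upper determinant bound, where single entries are
  recovered from the quadratic form by polarisation.\<close>

lemma hessian_symmetric:
  fixes u :: "real ^ 'n::finite \<Rightarrow> real"
  assumes u: "Ck_on 2 S u" and "open S" and "x \<in> S"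
  shows "hessian u x $ i $ j = hessian u x $ j $ i"
proof -
  have u1: "Ck_on (Suc 0) S u" "Ck_on (Suc 0) S (partial_derivative i u)" for i
    using u by (auto simp: numeral_2_eq_2)
  \<comment> \<open>Both mixed second derivatives are close to the same second difference quotient.\<close>
  have mixed: "\<exists>z. dist z x < r \<and>
      u (x + s *\<^sub>R axis i 1 + s *\<^sub>R axis j 1) - u (x + s *\<^sub>R axis i 1) - (u (x + s *\<^sub>R axis j 1) - u x)
        = s\<^sup>2 * partial_derivative j (partial_derivative i u) z"
    if r: "ball x r \<subseteq> S" and s: "0 < s" "2 * s < r" for r s i j
  proof -
    have near: "dist (x + b *\<^sub>R axis i 1 + c *\<^sub>R axis j 1) x < r"
      if "0 \<le> b" "b \<le> s" "0 \<le> c" "c \<le> s" for b c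
    proof -
      have "norm (b *\<^sub>R axis i 1 + c *\<^sub>R axis j 1 :: real ^ 'n) \<le> b + c"
        using norm_triangle_ineq[of "b *\<^sub>R axis i 1 :: real ^ 'n" "c *\<^sub>R axis j 1"] that
        by (simp add: norm_axis_1)
      then show ?thesis
        using that s by (simp add: dist_norm add.assoc)
    qed
    then have inS: "x + b *\<^sub>R axis i 1 + c *\<^sub>R axis j 1 \<in> S"
      if "0 \<le> b" "b \<le> s" "0 \<le> c" "c \<le> s" for b c
      using r that by (auto simp: dist_commute subset_eq)
    \<comment> \<open>The mean value theorem is used first in direction \<open>i\<close>, on the
      difference of two parallel restrictions of \<open>u\<close>, and then in direction
      \<open>j\<close>, on the i-th partial derivative.\<close>
    have D: "((\<lambda>t. u (x + s *\<^sub>R axis j 1 + t *\<^sub>R axis i 1) - u (x + t *\<^sub>R axis i 1)) has_real_derivative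
        partial_derivative i u (x + s *\<^sub>R axis j 1 + t *\<^sub>R axis i 1)
          - partial_derivative i u (x + t *\<^sub>R axis i 1)) (at t)"
      if "0 \<le> t" "t \<le> s" for t
      using inS[of t s] inS[of t 0] that s
      by (intro DERIV_diff partial_derivative_DERIV[OF u1(1)]) (auto simp: add_ac)
    from MVT2[OF s(1) D] obtain b where b: "0 < b" "b < s"
      "u (x + s *\<^sub>R axis j 1 + s *\<^sub>R axis i 1) - u (x + s *\<^sub>R axis i 1) - (u (x + s *\<^sub>R axis j 1) - u x)
       = s * (partial_derivative i u (x + s *\<^sub>R axis j 1 + b *\<^sub>R axis i 1)
          - partial_derivative i u (x + b *\<^sub>R axis i 1))"
      by auto
    have "x + b *\<^sub>R axis i 1 + (\<theta> * s) *\<^sub>R axis j 1 \<in> S" if "0 \<le> \<theta>" "\<theta> \<le> 1" for \<theta>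
      using that b s by (intro inS) (auto simp: mult_left_le_one_le)
    from partial_derivative_MVT[OF u1(2) this, of i]
    obtain \<theta> where \<theta>: "0 < \<theta>" "\<theta> < 1"
      "partial_derivative i u (x + b *\<^sub>R axis i 1 + s *\<^sub>R axis j 1) - partial_derivative i u (x + b *\<^sub>R axis i 1)
       = s * partial_derivative j (partial_derivative i u) (x + b *\<^sub>R axis i 1 + (\<theta> * s) *\<^sub>R axis j 1)"
      by metis
    have "dist (x + b *\<^sub>R axis i 1 + (\<theta> * s) *\<^sub>R axis j 1) x < r"
      using \<theta> b s by (intro near) (auto simp: mult_left_le_one_le)
    then show ?thesis
      using b(3) \<theta>(3) by (intro exI conjI) (auto simp: add_ac power2_eq_square)
  qed
  let ?H = "\<lambda>i j. partial_derivative j (partial_derivative i u)"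
  have cont: "isCont (?H i j) x" for i j
  proof -
    have "continuous_on S (?H i j)"
      using u1(2)[of i] by simp
    then show ?thesis
      using assms(2,3) continuous_on_eq_continuous_at by blast
  qed
  \<comment> \<open>The form \<open>0 + e\<close> is the one that \<open>field_le_epsilon\<close>
    expects.\<close>
  have "\<bar>?H i j x - ?H j i x\<bar> \<le> 0 + e" if e: "e > 0" for e
  proof -
    obtain \<rho> where \<rho>: "\<rho> > 0" "ball x \<rho> \<subseteq> S"
      using assms(2,3) open_contains_ball by blast
    obtain d where d: "d > 0" "\<And>y. dist y x < d \<Longrightarrow> dist (?H i j y) (?H i j x) < e / 2"
      using cont[where i = i and j = j] half_gt_zero[OF e] unfolding continuous_at_eps_delta by metis
    obtain d' where d': "d' > 0" "\<And>y. dist y x < d' \<Longrightarrow> dist (?H j i y) (?H j i x) < e / 2"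
      using cont[where i = j and j = i] half_gt_zero[OF e] unfolding continuous_at_eps_delta by metis
    define r where "r = min \<rho> (min d d')"
    have r: "r > 0" "ball x r \<subseteq> S"
      using \<rho> d(1) d'(1) by (auto simp: r_def)
    obtain z where z: "dist z x < r"
      "u (x + (r/3) *\<^sub>R axis i 1 + (r/3) *\<^sub>R axis j 1) - u (x + (r/3) *\<^sub>R axis i 1)
         - (u (x + (r/3) *\<^sub>R axis j 1) - u x) = (r/3)\<^sup>2 * ?H i j z"
      using mixed[OF r(2), of "r/3" i j] r(1) by auto
    obtain w where w: "dist w x < r"
      "u (x + (r/3) *\<^sub>R axis j 1 + (r/3) *\<^sub>R axis i 1) - u (x + (r/3) *\<^sub>R axis j 1)
         - (u (x + (r/3) *\<^sub>R axis i 1) - u x) = (r/3)\<^sup>2 * ?H j i w"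
      using mixed[OF r(2), of "r/3" j i] r(1) by auto
    \<comment> \<open>The second difference is symmetric in \<open>i\<close> and \<open>j\<close>,
      so its two representations agree.\<close>
    have "(r/3)\<^sup>2 * ?H i j z = (r/3)\<^sup>2 * ?H j i w"
      unfolding z(2)[symmetric] w(2)[symmetric] by (simp add: add_ac)
    then have "?H i j z = ?H j i w"
      using r(1) by simp
    moreover have "\<bar>?H i j z - ?H i j x\<bar> < e / 2" "\<bar>?H j i w - ?H j i x\<bar> < e / 2"
      using d(2)[of z] d'(2)[of w] z(1) w(1) by (simp_all add: r_def dist_real_def)
    ultimately show ?thesis
      by linarith
  qed
  then have "\<bar>?H i j x - ?H j i x\<bar> \<le> 0"
    by (rule field_le_epsilon)
  then show ?thesis
    by (simp add: hessian_def)
qed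

section \<open>Second order conditions at contact points\<close>

text \<open>Since \<open>g' 0 = 0\<close>, a negative \<open>l\<close> would make \<open>g'\<close>
  negative just to the right of 0, and by the mean value theorem \<open>g\<close> would drop below
  \<open>g 0\<close> there.\<close>

lemma local_min_imp_second_derivative_nonneg:
  fixes g g' :: "real \<Rightarrow> real"
  assumes "d > 0" and g: "\<And>t. \<bar>t\<bar> < d \<Longrightarrow> (g has_real_derivative g' t) (at t)"
    and g': "(g' has_real_derivative l) (at 0)"
    and min: "\<And>t. \<bar>t\<bar> < d \<Longrightarrow> g 0 \<le> g t"
  shows "0 \<le> l"
proof (rule ccontr)
  assume "\<not> 0 \<le> l"
  then obtain e where e: "e > 0" "\<And>h. 0 < h \<Longrightarrow> h < e \<Longrightarrow> g' h < g' 0"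
    using DERIV_neg_dec_right[OF g'] by auto
  have "g' 0 = 0"
    using DERIV_local_min[OF g[of 0] \<open>d > 0\<close>] min \<open>d > 0\<close> by simp
  define t where "t = min d e / 2"
  have t: "0 < t" "t < d" "t < e"
    using e(1) \<open>d > 0\<close> by (auto simp: t_def)
  have "\<exists>z. 0 < z \<and> z < t \<and> g t - g 0 = (t - 0) * g' z"
    using t by (intro MVT2 g) auto
  then obtain z where "0 < z" "z < t" "g t - g 0 = t * g' z"
    by auto
  moreover have "t * g' z < 0"
    using e(2)[of z] calculation t \<open>g' 0 = 0\<close> by (simp add: mult_pos_neg)
  ultimately show False
    using min[of t] t by simp
qed

lemma line_in_open:
  fixes x h :: "'a::real_normed_vector"
  assumes "open S" and "x \<in> S"
  obtains d where "d > 0" "\<And>t. \<bar>t\<bar> < d \<Longrightarrow> x + t *\<^sub>R h \<in> S"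
proof -
  obtain r where r: "r > 0" "ball x r \<subseteq> S"
    using assms open_contains_ball by blast
  \<comment> \<open>The added 1 keeps the denominator positive when \<open>h = 0\<close>.\<close>
  have "x + t *\<^sub>R h \<in> S" if "\<bar>t\<bar> < r / (norm h + 1)" for t
  proof -
    have "\<bar>t\<bar> * norm h \<le> \<bar>t\<bar> * (norm h + 1)"
      by (simp add: mult_left_mono)
    also have "\<dots> < r"
      using that by (simp add: pos_less_divide_eq add_nonneg_pos)
    finally show ?thesis
      using r(2) by (auto simp: subset_eq dist_norm)
  qed
  moreover have "r / (norm h + 1) > 0"
    using r(1) by (simp add: add_nonneg_pos)
  ultimately show thesis
    using that by blast
qed

text \<open>The sign \<open>\<sigma> = 1\<close> describes contact from below and \<open>\<sigma> = -1\<close> contact from above.\<close>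

lemma hessian_ge_at_contact:
  fixes u :: "real ^ 'n::finite \<Rightarrow> real"
  assumes u: "Ck_on 2 S u" and "open T" "T \<subseteq> S" "open S" "x \<in> T"
    and contact: "\<And>y. y \<in> T \<Longrightarrow> \<sigma> * u x - k / 2 * (norm x)\<^sup>2 \<le> \<sigma> * u y - k / 2 * (norm y)\<^sup>2"
  shows "k * (norm h)\<^sup>2 \<le> \<sigma> * (h \<bullet> (hessian u x *v h))"
proof -
  obtain d where d: "d > 0" "\<And>t. \<bar>t\<bar> < d \<Longrightarrow> x + t *\<^sub>R h \<in> T"
    using line_in_open[OF assms(2,5), of h] by blast
  have u1: "Ck_on (Suc 0) S u"
    using u by (auto simp: numeral_2_eq_2)
  define G where "G t = (\<Sum>i\<in>UNIV. h $ i * partial_derivative i u (x + t *\<^sub>R h))" for t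
  define q where "q t = (norm (x + t *\<^sub>R h))\<^sup>2" for t
  have q_eq: "q t = x \<bullet> x + 2 * t * (x \<bullet> h) + t\<^sup>2 * (h \<bullet> h)" for t
    unfolding q_def power2_norm_eq_inner
    by (simp add: inner_add_left inner_add_right inner_commute power2_eq_square algebra_simps)
  have D: "((\<lambda>t. \<sigma> * u (x + t *\<^sub>R h) - k / 2 * q t) has_real_derivative
      \<sigma> * G t - k / 2 * (2 * (x \<bullet> h) + 2 * t * (h \<bullet> h))) (at t)" if "\<bar>t\<bar> < d" for t
  proof (intro DERIV_diff DERIV_cmult)
    show "((\<lambda>t. u (x + t *\<^sub>R h)) has_real_derivative G t) (at t)"
      unfolding G_def using d(2)[OF that] assms(3) by (intro C1_directional_DERIV[OF u1 assms(4)]) auto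
    show "(q has_real_derivative 2 * (x \<bullet> h) + 2 * t * (h \<bullet> h)) (at t)"
      unfolding q_eq[abs_def] by (auto intro!: derivative_eq_intros)
  qed
  have "(G has_real_derivative h \<bullet> (hessian u x *v h)) (at 0)"
    unfolding G_def using assms by (intro hessian_directional_DERIV[OF u]) auto
  then have D': "((\<lambda>t. \<sigma> * G t - k / 2 * (2 * (x \<bullet> h) + 2 * t * (h \<bullet> h))) has_real_derivative
      \<sigma> * (h \<bullet> (hessian u x *v h)) - k * (h \<bullet> h)) (at 0)"
    by (auto intro!: derivative_eq_intros)
  have "0 \<le> \<sigma> * (h \<bullet> (hessian u x *v h)) - k * (h \<bullet> h)"
    using contact[OF d(2)] by (intro local_min_imp_second_derivative_nonneg[OF d(1) D D']) (auto simp: q_def)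
  then show ?thesis
    by (simp add: power2_norm_eq_inner)
qed

text \<open>By midpoint convexity the even function \<open>u (x + t h) + u (x - t h)\<close> of
  \<open>t\<close> is minimal at 0. Its second derivative there is twice the quadratic form.\<close>

lemma convex_imp_hessian_nonneg:
  fixes u :: "real ^ 'n::finite \<Rightarrow> real"
  assumes u: "Ck_on 2 S u" and "open S" "x \<in> S" and conv: "convex_on S u"
  shows "0 \<le> h \<bullet> (hessian u x *v h)"
proof -
  obtain d where d: "d > 0" "\<And>t. \<bar>t\<bar> < d \<Longrightarrow> x + t *\<^sub>R h \<in> S"
    using line_in_open[OF assms(2,3), of h] by blast
  have u1: "Ck_on (Suc 0) S u"
    using u by (auto simp: numeral_2_eq_2)
  define G where "G t = (\<Sum>i\<in>UNIV. h $ i * partial_derivative i u (x + t *\<^sub>R h))" for t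
  have E: "((\<lambda>t. u (x + t *\<^sub>R h)) has_real_derivative G t) (at t)" if "\<bar>t\<bar> < d" for t
    unfolding G_def using d(2)[OF that] by (intro C1_directional_DERIV[OF u1 assms(2)])
  have D: "((\<lambda>t. u (x + t *\<^sub>R h) + u (x + (- t) *\<^sub>R h)) has_real_derivative G t - G (- t)) (at t)"
    if "\<bar>t\<bar> < d" for t
  proof -
    have "((\<lambda>t. u (x + (- t) *\<^sub>R h)) has_real_derivative G (- t) * (- 1)) (at t)"
      by (rule DERIV_chain2[where f = "\<lambda>s. u (x + s *\<^sub>R h)" and g = uminus])
         (use E[of "- t"] that in \<open>auto intro!: derivative_eq_intros\<close>)
    from DERIV_add[OF E[OF that] this] show ?thesis
      by simp
  qed
  have G0: "(G has_real_derivative h \<bullet> (hessian u x *v h)) (at 0)"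
    unfolding G_def using assms by (intro hessian_directional_DERIV[OF u]) auto
  have "((\<lambda>t. G t - G (- t)) has_real_derivative 2 * (h \<bullet> (hessian u x *v h))) (at 0)"
  proof -
    have "((\<lambda>t. G (- t)) has_real_derivative (h \<bullet> (hessian u x *v h)) * (- 1)) (at 0)"
      by (rule DERIV_chain2[where f = G and g = uminus])
         (use G0 in \<open>auto intro!: derivative_eq_intros\<close>)
    from DERIV_diff[OF G0 this] show ?thesis
      by simp
  qed
  moreover have "u (x + 0 *\<^sub>R h) + u (x + (- 0) *\<^sub>R h) \<le> u (x + t *\<^sub>R h) + u (x + (- t) *\<^sub>R h)"
    if "\<bar>t\<bar> < d" for t
  proof -
    have "u ((1 - 1/2) *\<^sub>R (x + t *\<^sub>R h) + (1/2) *\<^sub>R (x + (- t) *\<^sub>R h))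
        \<le> (1 - 1/2) * u (x + t *\<^sub>R h) + 1/2 * u (x + (- t) *\<^sub>R h)"
      using that by (intro convex_onD[OF conv] d(2)) auto
    moreover have "(1 - 1/2) *\<^sub>R (x + t *\<^sub>R h) + (1/2) *\<^sub>R (x + (- t) *\<^sub>R h) = x"
      by (simp add: algebra_simps flip: scaleR_add_left)
    ultimately show ?thesis
      by simp
  qed
  ultimately have "0 \<le> 2 * (h \<bullet> (hessian u x *v h))"
    by (intro local_min_imp_second_derivative_nonneg[OF d(1) D])
  then show ?thesis
    by simp
qed

section \<open>Determinants of bounded and of coercive matrices\<close>

text \<open>The Leibniz expansion has N! terms, each a signed product of N entries.\<close>

lemma abs_det_le_fact:
  fixes A :: "real ^ 'n ^ 'n::finite"
  assumes "\<And>i j. \<bar>A $ i $ j\<bar> \<le> k"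
  shows "\<bar>det A\<bar> \<le> fact CARD('n) * k ^ CARD('n)"
proof -
  have "\<bar>det A\<bar> \<le> (\<Sum>p | p permutes (UNIV::'n set). \<bar>of_int (sign p) * (\<Prod>i\<in>UNIV. A $ i $ p i)\<bar>)"
    unfolding det_def by (rule sum_abs)
  also have "\<dots> \<le> (\<Sum>p | p permutes (UNIV::'n set). k ^ CARD('n))"
  proof (rule sum_mono)
    fix p :: "'n \<Rightarrow> 'n"
    have "\<bar>of_int (sign p) * (\<Prod>i\<in>UNIV. A $ i $ p i)\<bar> = (\<Prod>i\<in>UNIV. \<bar>A $ i $ p i\<bar>)"
      by (simp add: abs_mult abs_prod sign_def)
    also have "\<dots> \<le> (\<Prod>i\<in>(UNIV::'n set). k)"
      using assms by (intro prod_mono) auto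
    finally show "\<bar>of_int (sign p) * (\<Prod>i\<in>UNIV. A $ i $ p i)\<bar> \<le> k ^ CARD('n)"
      by simp
  qed
  also have "\<dots> = fact CARD('n) * k ^ CARD('n)"
    using card_permutations[of "UNIV::'n set" "CARD('n)"] by simp
  finally show ?thesis .
qed

text \<open>Polarisation: four times an entry is the difference of the form at
  \<open>e_i + e_j\<close> and at \<open>e_i - e_j\<close>. Both values lie in [0, 4k], because
  these vectors have norm at most 2, a bound attained when \<open>i = j\<close>.\<close>

lemma abs_det_le_of_quadratic_form:
  fixes A :: "real ^ 'n ^ 'n::finite"
  assumes sym: "\<And>i j. A $ i $ j = A $ j $ i"
    and nonneg: "\<And>h. 0 \<le> h \<bullet> (A *v h)" and le: "\<And>h. h \<bullet> (A *v h) \<le> k * (norm h)\<^sup>2"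
  shows "\<bar>det A\<bar> \<le> fact CARD('n) * k ^ CARD('n)"
proof (rule abs_det_le_fact)
  fix i j
  let ?e = "axis i 1 :: real ^ 'n" and ?f = "axis j 1 :: real ^ 'n"
  have ax: "axis i 1 \<bullet> (A *v axis j 1) = A $ i $ j" for i j
    by (simp add: inner_axis' matrix_vector_mult_basis column_def)
  have "(?e + ?f) \<bullet> (A *v (?e + ?f)) - (?e - ?f) \<bullet> (A *v (?e - ?f)) = 2 * (A $ i $ j + A $ j $ i)"
    by (simp add: matrix_vector_right_distrib matrix_vector_mult_diff_distrib
        inner_add_left inner_add_right inner_diff_left inner_diff_right ax)
  then have 4: "4 * A $ i $ j = (?e + ?f) \<bullet> (A *v (?e + ?f)) - (?e - ?f) \<bullet> (A *v (?e - ?f))"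
    using sym[of i j] by simp
  have "0 \<le> k"
    using order_trans[OF nonneg le, of ?e] by (simp add: norm_axis_1)
  have "norm (?e + ?f) \<le> 2" "norm (?e - ?f) \<le> 2"
    using norm_triangle_ineq[of ?e ?f] norm_triangle_ineq4[of ?e ?f] by (simp_all add: norm_axis_1)
  then have "(norm (?e + ?f))\<^sup>2 \<le> 2\<^sup>2" "(norm (?e - ?f))\<^sup>2 \<le> 2\<^sup>2"
    by (intro power_mono; simp)+
  then have "k * (norm (?e + ?f))\<^sup>2 \<le> k * 4" "k * (norm (?e - ?f))\<^sup>2 \<le> k * 4"
    using \<open>0 \<le> k\<close> by (auto intro!: mult_left_mono)
  then show "\<bar>A $ i $ j\<bar> \<le> k"
    using 4 nonneg[of "?e + ?f"] nonneg[of "?e - ?f"] le[of "?e + ?f"] le[of "?e - ?f"] by linarith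
qed

text \<open>Coercivity makes \<open>A\<close> injective, hence invertible. A column \<open>g\<close>
  of the inverse satisfies \<open>A g = e_j\<close>, so \<open>k |g|^2 \<le> |g|\<close> and its
  entries are at most \<open>1 / k\<close>; the upper bound for the determinant of the inverse is
  then inverted.\<close>

lemma abs_det_ge_of_coercive:
  fixes A :: "real ^ 'n ^ 'n::finite"
  assumes "k > 0" and ge: "\<And>h. k * (norm h)\<^sup>2 \<le> h \<bullet> (A *v h)"
  shows "k ^ CARD('n) \<le> fact CARD('n) * \<bar>det A\<bar>"
proof -
  have "h = 0" if "A *v h = 0" for h
    using ge[of h] that \<open>k > 0\<close> by (simp add: mult_le_0_iff)
  then obtain B where BA: "B ** A = mat 1"
    using matrix_left_invertible_ker[of A] by auto
  then have AB: "A ** B = mat 1"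
    by (simp add: matrix_left_right_inverse)
  have "\<bar>B $ i $ j\<bar> \<le> 1 / k" for i j
  proof -
    let ?e = "axis j 1 :: real ^ 'n"
    define g where "g = B *v ?e"
    have "A *v g = ?e"
      by (simp add: g_def matrix_vector_mul_assoc AB)
    then have "k * (norm g)\<^sup>2 \<le> norm g * 1"
      using ge[of g] norm_cauchy_schwarz[of g ?e] by (simp add: norm_axis_1)
    then have "k * norm g \<le> 1"
      by (cases "g = 0") (auto simp: power2_eq_square)
    moreover have "\<bar>g $ i\<bar> \<le> norm g"
      by (rule component_le_norm_cart)
    moreover have "g $ i = B $ i $ j"
      by (simp add: g_def matrix_vector_mult_basis column_def)
    ultimately show ?thesis
      using \<open>k > 0\<close> order_trans[of "\<bar>g $ i\<bar>" "norm g" "1 / k"]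
      by (simp add: pos_le_divide_eq mult.commute)
  qed
  then have "\<bar>det B\<bar> \<le> fact CARD('n) * (1 / k) ^ CARD('n)"
    by (rule abs_det_le_fact)
  then have "\<bar>det B\<bar> * \<bar>det A\<bar> \<le> fact CARD('n) * (1 / k) ^ CARD('n) * \<bar>det A\<bar>"
    by (rule mult_right_mono) simp
  also have "\<bar>det B\<bar> * \<bar>det A\<bar> = 1"
    using BA by (metis abs_mult abs_one det_I det_mul)
  finally show ?thesis
    using \<open>k > 0\<close> by (simp add: power_one_over field_simps)
qed

section \<open>Convex functions vanishing on the boundary\<close>

text \<open>Convexity holds on the open set only, so the chord through \<open>x\<close> is first
  shortened to lie inside; continuity then carries the inequality to the endpoints, where
  \<open>u\<close> vanishes.\<close>

lemma convex_zero_frontier_nonpos: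
  fixes u :: "'a::euclidean_space \<Rightarrow> real"
  assumes "open S" "bounded S" and conv: "convex_on S u" and cont: "continuous_on (closure S) u"
    and zero: "\<And>x. x \<in> frontier S \<Longrightarrow> u x = 0" and "x \<in> S"
  shows "u x \<le> 0"
proof -
  obtain l :: 'a where "l \<in> Basis"
    using nonempty_Basis by blast
  then have l: "l \<noteq> 0"
    by auto
  have x: "x \<in> interior S"
    using assms by (simp add: interior_open)
  obtain b where b: "b > 0" "x + b *\<^sub>R l \<in> frontier S" "\<And>e. 0 \<le> e \<Longrightarrow> e < b \<Longrightarrow> x + e *\<^sub>R l \<in> interior S"
    using ray_to_frontier[OF \<open>bounded S\<close> x l] by metis
  obtain c where c: "c > 0" "x + c *\<^sub>R (- l) \<in> frontier S"
    "\<And>e. 0 \<le> e \<Longrightarrow> e < c \<Longrightarrow> x + e *\<^sub>R (- l) \<in> interior S"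
    using ray_to_frontier[OF \<open>bounded S\<close> x, of "- l"] l by (metis neg_equal_0_iff_equal)
  \<comment> \<open>As \<open>t\<close> goes from 0 to 1, \<open>p t\<close> and \<open>q t\<close>
    move from \<open>x\<close> to the two ends of the chord.\<close>
  define p q where "p t = x + (t * b) *\<^sub>R l" and "q t = x + (t * c) *\<^sub>R (- l)" for t
  \<comment> \<open>This weight solves \<open>(1 - w) b = w c\<close>, so \<open>x\<close> is the
    same convex combination of \<open>p t\<close> and \<open>q t\<close> for every
    \<open>t\<close>.\<close>
  define w where "w = b / (b + c)"
  define F where "F t = (1 - w) * u (p t) + w * u (q t)" for t
  have inS: "p t \<in> S" "q t \<in> S" if "0 \<le> t" "t < 1" for t
    using b(3)[of "t * b"] c(3)[of "t * c"] that b(1) c(1) interior_subset[of S]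
    by (auto simp: p_def q_def)
  have cl: "p t \<in> closure S" "q t \<in> closure S" if "0 \<le> t" "t \<le> 1" for t
  proof -
    have "p t \<in> closure S \<and> q t \<in> closure S"
    proof (cases "t = 1")
      case True
      then show ?thesis
        using b(2) c(2) by (auto simp: p_def q_def frontier_def)
    next
      case False
      then show ?thesis
        using inS[of t] that closure_subset[of S] by auto
    qed
    then show "p t \<in> closure S" "q t \<in> closure S"
      by auto
  qed
  have "u x \<le> F t" if "t \<in> {0..<1}" for t
  proof -
    have "(1 - w) * b = w * c"
      using b(1) c(1) by (simp add: w_def field_simps)
    then have "((1 - w) * (t * b)) *\<^sub>R l = (w * (t * c)) *\<^sub>R l"
      by (metis mult.left_commute)
    moreover have "(1 - w) *\<^sub>R p t + w *\<^sub>R q t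
        = x + (((1 - w) * (t * b)) *\<^sub>R l - (w * (t * c)) *\<^sub>R l)"
      by (simp add: p_def q_def algebra_simps)
    ultimately have "(1 - w) *\<^sub>R p t + w *\<^sub>R q t = x"
      by simp
    moreover have "u ((1 - w) *\<^sub>R p t + w *\<^sub>R q t) \<le> (1 - w) * u (p t) + w * u (q t)"
      using that b(1) c(1) by (intro convex_onD[OF conv] inS) (auto simp: w_def)
    ultimately show ?thesis
      by (simp add: F_def)
  qed
  moreover have "continuous_on {0..1} F"
  proof -
    have "continuous_on {0..1} (\<lambda>t. u (p t))" "continuous_on {0..1} (\<lambda>t. u (q t))"
      using cl by (auto intro!: continuous_on_compose2[OF cont] continuous_intros simp: p_def[abs_def] q_def[abs_def])
    then show ?thesis
      unfolding F_def by (intro continuous_intros)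
  qed
  ultimately have "u x \<le> F 1"
    by (intro continuous_ge_on_closure[of "{0..<1}" F 1 "u x"]) auto
  also have "F 1 = 0"
    using zero[OF b(2)] zero[OF c(2)] by (simp add: F_def p_def q_def)
  finally show ?thesis .
qed

text \<open>With \<open>t = r / (2 r + R)\<close>, the point \<open>z\<close> defined by \<open>x = (1 - t) z + t y\<close> is within distance \<open>r\<close> of \<open>x\<close>.\<close>

lemma convex_nonpos_interior_bound:
  fixes u :: "'a::real_normed_vector \<Rightarrow> real"
  assumes conv: "convex_on S u" and nonpos: "\<And>z. z \<in> S \<Longrightarrow> u z \<le> 0"
    and "cball 0 (2 * r) \<subseteq> S" and "S \<subseteq> cball 0 R" and "r > 0" "R > 0"
    and x: "x \<in> cball 0 r" and y: "y \<in> S"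
  shows "u x \<le> r / (2 * r + R) * u y"
proof -
  define t where "t = r / (2 * r + R)"
  define z where "z = x + (r / (r + R)) *\<^sub>R (x - y)"
  have t: "0 < t" "t < 1" "(1 - t) * (r / (r + R)) = t"
  proof -
    have "1 - t = (r + R) / (2 * r + R)"
      using assms(5,6) by (simp add: t_def field_simps)
    then show "(1 - t) * (r / (r + R)) = t"
      using assms(5,6) by (simp add: t_def)
  qed (use assms(5,6) in \<open>auto simp: t_def\<close>)
  have "norm (x - y) \<le> r + R"
    using norm_triangle_ineq4[of x y] x y assms(4) by (auto simp: subset_eq)
  then have "norm ((r / (r + R)) *\<^sub>R (x - y)) \<le> r"
    using assms(5,6) by (simp add: pos_divide_le_eq mult_left_mono del: scaleR_right_diff_distrib)
  then have "norm z \<le> 2 * r"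
    using x norm_triangle_ineq[of x "(r / (r + R)) *\<^sub>R (x - y)"] by (simp add: z_def)
  then have z: "z \<in> S"
    using assms(3) by auto
  have "(1 - t) *\<^sub>R z + t *\<^sub>R y = (1 - t) *\<^sub>R x + t *\<^sub>R (x - y) + t *\<^sub>R y"
    by (simp only: z_def scaleR_add_right scaleR_scaleR t(3))
  then have "(1 - t) *\<^sub>R z + t *\<^sub>R y = x"
    by (simp add: algebra_simps)
  moreover have "u ((1 - t) *\<^sub>R z + t *\<^sub>R y) \<le> (1 - t) * u z + t * u y"
    using t z y by (intro convex_onD[OF conv]) auto
  moreover have "(1 - t) * u z \<le> 0"
    using t nonpos[OF z] by (simp add: mult_nonneg_nonpos)
  ultimately show ?thesis
    by (simp add: t_def)
qed

section \<open>Growth of the nonlinearity\<close>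

text \<open>The limits bound the quotient near 0 and near infinity. On the range from
  \<open>b\<close> to \<open>B\<close> between them, monotonicity bounds the numerator by its value
  at the right end, and the denominator is at least \<open>b ^ n\<close>.\<close>

lemma power_growth_upper:
  fixes f :: "real \<Rightarrow> real" and f0 finf :: ereal
  assumes mono: "mono_on {0..} f" and nonneg: "\<And>s. s \<ge> 0 \<Longrightarrow> f s \<ge> 0"
    and lim0: "((\<lambda>s. ereal (f s / s ^ n)) \<longlongrightarrow> f0) (at_right 0)"
    and liminf: "((\<lambda>s. ereal (f s / s ^ n)) \<longlongrightarrow> finf) at_top"
    and "f0 \<noteq> \<infinity>" "finf \<noteq> \<infinity>"
  obtains C where "C > 0" "\<And>s. s > 0 \<Longrightarrow> f s \<le> C * s ^ n"
proof -
  obtain c0 c1 where c: "f0 < ereal c0" "finf < ereal c1"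
    using assms(5,6) by (metis ereal_dense2 ereal_infty_less(1))
  obtain b where b: "b > 0" "\<And>s. 0 < s \<Longrightarrow> s < b \<Longrightarrow> f s / s ^ n < c0"
    using order_tendstoD(2)[OF lim0 c(1)] by (auto simp: eventually_at_right_field)
  obtain B where B: "\<And>s. s \<ge> B \<Longrightarrow> f s / s ^ n < c1"
    using order_tendstoD(2)[OF liminf c(2)] by (auto simp: eventually_at_top_linorder)
  \<comment> \<open>\<open>B\<close> may lie below \<open>b\<close> or even be negative; the maximum
    keeps the argument of \<open>f\<close> positive.\<close>
  define D where "D = f (max B b) / b ^ n"
  define C where "C = max 1 (max c0 (max c1 D))"
  have "f s \<le> C * s ^ n" if s: "s > 0" for s
  proof -
    have "f s / s ^ n \<le> C"
    proof (cases "s < b \<or> s \<ge> B")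
      case True
      then show ?thesis
        using b(2)[of s] B[of s] s by (auto simp: C_def)
    next
      case False
      then have "f s / s ^ n \<le> f (max B b) / b ^ n"
        using b(1) s nonneg[of "max B b"] by (intro frac_le mono_onD[OF mono] power_mono) auto
      then show ?thesis
        by (simp add: C_def D_def)
    qed
    then show ?thesis
      using s by (simp add: pos_divide_le_eq)
  qed
  then show thesis
    using that[of C] by (simp add: C_def)
qed

text \<open>Mirror image of the upper bound: on the middle range the numerator is at least
  \<open>f b\<close> and the denominator at most the power of the right end. Infinite limits are
  covered, since only some positive real below each limit is taken.\<close>

lemma power_growth_lower:
  fixes f :: "real \<Rightarrow> real" and f0 finf :: ereal
  assumes mono: "mono_on {0..} f" and pos: "\<And>s. s > 0 \<Longrightarrow> f s > 0"
    and lim0: "((\<lambda>s. ereal (f s / s ^ n)) \<longlongrightarrow> f0) (at_right 0)"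
    and liminf: "((\<lambda>s. ereal (f s / s ^ n)) \<longlongrightarrow> finf) at_top"
    and "f0 > 0" "finf > 0"
  obtains c where "c > 0" "\<And>s. s > 0 \<Longrightarrow> c * s ^ n \<le> f s"
proof -
  obtain c0 c1 where c: "ereal c0 < f0" "c0 > 0" "ereal c1 < finf" "c1 > 0"
    using assms(5,6) by (metis ereal_dense2 ereal_less(2))
  obtain b where b: "b > 0" "\<And>s. 0 < s \<Longrightarrow> s < b \<Longrightarrow> c0 < f s / s ^ n"
    using order_tendstoD(1)[OF lim0 c(1)] by (auto simp: eventually_at_right_field)
  obtain B where B: "\<And>s. s \<ge> B \<Longrightarrow> c1 < f s / s ^ n"
    using order_tendstoD(1)[OF liminf c(3)] by (auto simp: eventually_at_top_linorder)
  define D where "D = f b / (max B b) ^ n"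
  define C where "C = min c0 (min c1 D)"
  have "D > 0"
    using pos[OF b(1)] b(1) by (simp add: D_def)
  have "C * s ^ n \<le> f s" if s: "s > 0" for s
  proof -
    have "C \<le> f s / s ^ n"
    proof (cases "s < b \<or> s \<ge> B")
      case True
      then show ?thesis
        using b(2)[of s] B[of s] s by (auto simp: C_def)
    next
      case False
      then have "f b / (max B b) ^ n \<le> f s / s ^ n"
        using b(1) s pos[OF s] by (intro frac_le mono_onD[OF mono] power_mono) auto
      then show ?thesis
        by (simp add: C_def D_def)
    qed
    then show ?thesis
      using s by (simp add: pos_le_divide_eq)
  qed
  then show thesis
    using that[of C] c \<open>D > 0\<close> by (simp add: C_def)
qed

section \<open>Comparison with paraboloids\<close>

text \<open>Nontriviality together with \<open>u \<le> 0\<close> makes the minimum over the closure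
  negative, which excludes the frontier.\<close>

lemma convex_solution_minimum:
  fixes \<Omega> :: "(real ^ 'n::finite) set"
  assumes "open \<Omega>" "bounded \<Omega>" and sol: "convex_solution \<Omega> a f lam u"
  obtains y where "y \<in> \<Omega>" "u y < 0" "\<And>x. x \<in> closure \<Omega> \<Longrightarrow> u y \<le> u x" "\<And>x. x \<in> \<Omega> \<Longrightarrow> u x \<le> 0"
proof -
  have conv: "convex_on \<Omega> u" and cont: "continuous_on (closure \<Omega>) u"
    and zero: "\<And>x. x \<in> frontier \<Omega> \<Longrightarrow> u x = 0"
    using sol by (auto simp: convex_solution_def)
  obtain x0 where x0: "x0 \<in> \<Omega>" "u x0 \<noteq> 0"
    using sol by (auto simp: convex_solution_def)
  have np: "u x \<le> 0" if "x \<in> \<Omega>" for x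
    using convex_zero_frontier_nonpos[OF assms(1,2) conv cont zero that] .
  have "compact (closure \<Omega>)"
    using assms(2) by (rule compact_closure[THEN iffD2])
  moreover have "closure \<Omega> \<noteq> {}"
    using x0(1) by auto
  ultimately obtain y where y: "y \<in> closure \<Omega>" "\<And>x. x \<in> closure \<Omega> \<Longrightarrow> u y \<le> u x"
    using continuous_attains_inf[OF _ _ cont] by blast
  have "u y < 0"
    using y(2)[of x0] x0 np[of x0] closure_subset[of \<Omega>] by force
  moreover have "y \<in> \<Omega>"
    using calculation zero[of y] y(1) assms(1) by (auto simp: frontier_def interior_open)
  ultimately show thesis
    using that y(2) np by blast
qed

text \<open>The threshold is \<open>2 / (B R^2)\<close>, where \<open>R\<close> bounds the norm on
  the domain and \<open>B\<close> collects the bound on \<open>a\<close>, the growth constant and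
  the factorial.\<close>

lemma no_convex_solution_small:
  fixes \<Omega> :: "(real ^ 'n::finite) set"
  assumes "open \<Omega>" "bounded \<Omega>"
    and a: "continuous_on (closure \<Omega>) a" "\<And>x. x \<in> closure \<Omega> \<Longrightarrow> a x \<ge> 0"
    and mono: "mono_on {0..} f" and nonneg: "\<And>s. s \<ge> 0 \<Longrightarrow> f s \<ge> 0"
    and C: "C > 0" "\<And>s. s > 0 \<Longrightarrow> f s \<le> C * s ^ CARD('n)"
  obtains \<mu> where "\<mu> > 0" "\<And>lam u. 0 < lam \<Longrightarrow> lam < \<mu> \<Longrightarrow> \<not> convex_solution \<Omega> a f lam u"
proof -
  let ?n = "CARD('n)"
  have "bounded (a ` closure \<Omega>)"
    using assms(2) a(1) by (intro compact_imp_bounded compact_continuous_image) (auto simp: compact_closure)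
  then obtain A where A: "A > 0" "\<And>x. x \<in> closure \<Omega> \<Longrightarrow> a x \<le> A"
    unfolding bounded_pos by (auto simp: abs_le_iff)
  have "bounded (closure \<Omega>)"
    using assms(2) by (rule bounded_closure)
  then obtain R where R: "R > 0" "\<And>x. x \<in> closure \<Omega> \<Longrightarrow> norm x \<le> R"
    unfolding bounded_pos by auto
  \<comment> \<open>The summand 1 gives both \<open>B > 1\<close>, hence
    \<open>B \<le> B ^ N\<close>, and strictness; this replaces taking an N-th root.\<close>
  define B where "B = fact ?n * A * C + 1"
  have "fact ?n * A * C > 0"
    using A(1) C(1) by simp
  then have B: "B > 1"
    by (simp add: B_def)
  have "B \<le> B ^ ?n"
    using B self_le_power[of B ?n] by simp
  then have Bn: "fact ?n * A * C < B ^ ?n"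
    by (simp add: B_def)
  have False if lam: "0 < lam" "lam < 2 / (B * R\<^sup>2)" and sol: "convex_solution \<Omega> a f lam u" for lam u
  proof -
    obtain y where y: "y \<in> \<Omega>" "u y < 0" "\<And>x. x \<in> closure \<Omega> \<Longrightarrow> u y \<le> u x" "\<And>x. x \<in> \<Omega> \<Longrightarrow> u x \<le> 0"
      using convex_solution_minimum[OF assms(1,2) sol] by blast
    have cont: "continuous_on (closure \<Omega>) u" and u: "Ck_on 2 \<Omega> u"
      and zero: "\<And>x. x \<in> frontier \<Omega> \<Longrightarrow> u x = 0"
      and eq: "\<And>x. x \<in> \<Omega> \<Longrightarrow> det (hessian u x) = lam ^ ?n * a x * f (- u x)"
      using sol by (auto simp: convex_solution_def)
    define M where "M = - u y"
    \<comment> \<open>The factor \<open>lam * M\<close> makes both determinant estimates scale like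
      \<open>(lam * M) ^ N\<close>, so the unknown depth \<open>M\<close> cancels.\<close>
    define k where "k = lam * B * M"
    have M: "M > 0" and k: "k > 0"
      using y(2) lam(1) B by (simp_all add: M_def k_def mult_pos_neg)
    have det_lt: "fact ?n * \<bar>det (hessian u x)\<bar> < k ^ ?n" if "x \<in> \<Omega>" for x
    proof -
      have x: "x \<in> closure \<Omega>"
        using that closure_subset by auto
      have "0 \<le> f (- u x)"
        using y(4)[OF that] nonneg by simp
      \<comment> \<open>Monotonicity passes from \<open>- u x\<close>, known only to be nonnegative,
        to \<open>M > 0\<close>, where the growth bound applies.\<close>
      have "f (- u x) \<le> f M"
        using y(3)[OF x] y(4)[OF that] by (intro mono_onD[OF mono]) (auto simp: M_def)
      also have "\<dots> \<le> C * M ^ ?n"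
        using C(2) M by simp
      finally have "a x * f (- u x) \<le> A * (C * M ^ ?n)"
        using A x \<open>0 \<le> f (- u x)\<close> by (intro mult_mono) auto
      moreover have "\<bar>det (hessian u x)\<bar> = lam ^ ?n * (a x * f (- u x))"
        using eq[OF that] a(2)[OF x] \<open>0 \<le> f (- u x)\<close> lam(1) by (simp add: abs_mult)
      ultimately have "\<bar>det (hessian u x)\<bar> \<le> lam ^ ?n * (A * (C * M ^ ?n))"
        using lam(1) by (simp add: mult_left_mono)
      then have "fact ?n * \<bar>det (hessian u x)\<bar> \<le> fact ?n * (lam ^ ?n * (A * (C * M ^ ?n)))"
        by (intro mult_left_mono) auto
      also have "\<dots> = (fact ?n * A * C) * (lam * M) ^ ?n"
        by (simp add: power_mult_distrib)
      also have "\<dots> < B ^ ?n * (lam * M) ^ ?n"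
        using Bn lam(1) M by (intro mult_strict_right_mono) auto
      also have "\<dots> = k ^ ?n"
        by (simp add: k_def power_mult_distrib)
      finally show ?thesis .
    qed
    have "continuous_on (closure \<Omega>) (\<lambda>x. u x - k / 2 * (norm x)\<^sup>2)"
      using cont by (intro continuous_intros)
    moreover have "compact (closure \<Omega>)" "closure \<Omega> \<noteq> {}"
      using assms(2) y(1) by (auto simp: compact_closure)
    ultimately obtain z where z: "z \<in> closure \<Omega>"
      "\<And>x. x \<in> closure \<Omega> \<Longrightarrow> u z - k / 2 * (norm z)\<^sup>2 \<le> u x - k / 2 * (norm x)\<^sup>2"
      using continuous_attains_inf[of "closure \<Omega>" "\<lambda>x. u x - k / 2 * (norm x)\<^sup>2"] by blast
    have "z \<notin> \<Omega>"
    proof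
      assume "z \<in> \<Omega>"
      have "k * (norm h)\<^sup>2 \<le> 1 * (h \<bullet> (hessian u z *v h))" for h
        using assms(1) \<open>z \<in> \<Omega>\<close> z(2) closure_subset[of \<Omega>]
        by (intro hessian_ge_at_contact[OF u assms(1)]) auto
      then have "k ^ ?n \<le> fact ?n * \<bar>det (hessian u z)\<bar>"
        by (intro abs_det_ge_of_coercive[OF k]) simp
      with det_lt[OF \<open>z \<in> \<Omega>\<close>] show False
        by simp
    qed
    then have "u z = 0"
      using z(1) zero assms(1) by (auto simp: frontier_def interior_open)
    moreover have "y \<in> closure \<Omega>"
      using y(1) closure_subset by auto
    ultimately have "- (k / 2 * (norm z)\<^sup>2) \<le> - M - k / 2 * (norm y)\<^sup>2"
      using z(2)[of y] by (simp add: M_def)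
    moreover have "0 \<le> k / 2 * (norm y)\<^sup>2"
      using k by simp
    moreover have "k / 2 * (norm z)\<^sup>2 \<le> k / 2 * R\<^sup>2"
      using k R z(1) by (intro mult_left_mono power_mono) auto
    ultimately have "M * 1 \<le> M * (lam * B / 2 * R\<^sup>2)"
      by (simp add: k_def mult_ac)
    then have "1 \<le> lam * B / 2 * R\<^sup>2"
      using M by (simp only: mult_le_cancel_left_pos)
    moreover have "lam * (B * R\<^sup>2) < 2"
      using lam(2) B R(1) by (simp add: pos_less_divide_eq)
    ultimately show False
      by simp
  qed
  then show thesis
    using that[of "2 / (B * R\<^sup>2)"] B R(1) by fastforce
qed

text \<open>Both \<open>a\<close> and \<open>- u\<close> may degenerate at the boundary, so the
  comparison takes place on a closed ball inside the domain, where \<open>a\<close> has a positive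
  minimum and \<open>- u\<close> is at least a fixed fraction of \<open>M\<close>.\<close>

lemma no_convex_solution_large:
  fixes \<Omega> :: "(real ^ 'n::finite) set"
  assumes "open \<Omega>" "bounded \<Omega>" "0 \<in> \<Omega>"
    and a: "continuous_on (closure \<Omega>) a" "\<And>x. x \<in> \<Omega> \<Longrightarrow> a x > 0"
    and c: "c > 0" "\<And>s. s > 0 \<Longrightarrow> c * s ^ CARD('n) \<le> f s"
  obtains \<mu> where "\<mu> > 0" "\<And>lam u. \<mu> < lam \<Longrightarrow> \<not> convex_solution \<Omega> a f lam u"
proof -
  let ?n = "CARD('n)"
  obtain r0 where r0: "r0 > 0" "cball 0 r0 \<subseteq> \<Omega>"
    using assms(1,3) open_contains_cball by blast
  \<comment> \<open>Halving leaves room for the ball of radius \<open>2 * r\<close> that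
    \<open>convex_nonpos_interior_bound\<close> requires.\<close>
  define r where "r = r0 / 2"
  have r: "r > 0" "cball 0 (2 * r) \<subseteq> \<Omega>"
    using r0 by (auto simp: r_def)
  then have r\<Omega>: "cball 0 r \<subseteq> \<Omega>"
    by (auto simp: subset_eq)
  obtain R where R: "R > 0" "\<Omega> \<subseteq> cball 0 R"
    using assms(2) unfolding bounded_pos by (auto simp: subset_eq)
  have "continuous_on (cball 0 r) a"
    using a(1) r\<Omega> closure_subset by (blast intro: continuous_on_subset)
  moreover have "cball 0 r \<noteq> ({} :: (real ^ 'n) set)"
    using r(1) by simp
  ultimately obtain xa where xa: "xa \<in> cball 0 r" "\<And>x. x \<in> cball 0 r \<Longrightarrow> a xa \<le> a x"
    using continuous_attains_inf[OF compact_cball] by metis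
  define a0 where "a0 = a xa"
  have a0: "a0 > 0"
    using a(2) xa(1) r\<Omega> by (auto simp: a0_def)
  define s where "s = r / (2 * r + R)"
  have s: "s > 0"
    using r(1) R(1) by (simp add: s_def)
  \<comment> \<open>With \<open>b \<le> 1\<close> one has \<open>b ^ N \<le> b\<close>, again
    avoiding a root; the factor 2 provides strictness.\<close>
  define b where "b = min 1 (a0 * c / (2 * fact ?n))"
  have b: "0 < b" "b \<le> 1"
    using a0 c(1) by (auto simp: b_def)
  have "b ^ ?n \<le> b ^ 1"
    using b by (intro power_decreasing) auto
  also have "\<dots> < a0 * c / fact ?n"
  proof -
    have "b \<le> a0 * c / fact ?n / 2"
      by (simp add: b_def)
    moreover have "a0 * c / fact ?n > 0"
      using a0 c(1) by simp
    ultimately show ?thesis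
      by simp
  qed
  finally have bn: "fact ?n * b ^ ?n < a0 * c"
    by (simp add: pos_less_divide_eq mult.commute)
  have False if lam: "2 / (b * s * r\<^sup>2) < lam" and sol: "convex_solution \<Omega> a f lam u" for lam u
  proof -
    have "0 < 2 / (b * s * r\<^sup>2)"
      using b s r by simp
    with lam have lam0: "0 < lam"
      by linarith
    obtain y where y: "y \<in> \<Omega>" "u y < 0" "\<And>x. x \<in> closure \<Omega> \<Longrightarrow> u y \<le> u x" "\<And>x. x \<in> \<Omega> \<Longrightarrow> u x \<le> 0"
      using convex_solution_minimum[OF assms(1,2) sol] by blast
    have cont: "continuous_on (closure \<Omega>) u" and u: "Ck_on 2 \<Omega> u" and conv: "convex_on \<Omega> u"
      and eq: "\<And>x. x \<in> \<Omega> \<Longrightarrow> det (hessian u x) = lam ^ ?n * a x * f (- u x)"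
      using sol by (auto simp: convex_solution_def)
    define M where "M = - u y"
    define k where "k = lam * (b * (s * M))"
    have M: "M > 0" and k: "k > 0"
      using y(2) lam0 b s by (simp_all add: M_def k_def mult_pos_neg)
    have det_gt: "fact ?n * k ^ ?n < det (hessian u x)" if x: "x \<in> cball 0 r" for x
    proof -
      have "u x \<le> s * u y"
        unfolding s_def using convex_nonpos_interior_bound[OF conv y(4) r(2) R(2) r(1) R(1) x y(1)] .
      then have sM: "s * M \<le> - u x" "0 < s * M"
        using s M by (simp_all add: M_def mult_pos_neg)
      have "c * (s * M) ^ ?n \<le> c * (- u x) ^ ?n"
        using sM c(1) by (intro mult_left_mono power_mono) auto
      also have "\<dots> \<le> f (- u x)"
        using c(2) sM by simp
      finally have "a0 * (c * (s * M) ^ ?n) \<le> a x * f (- u x)"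
        using xa(2)[OF x] a0 c(1) sM(2) by (intro mult_mono) (auto simp: a0_def)
      moreover have "fact ?n * b ^ ?n * (s * M) ^ ?n < a0 * c * (s * M) ^ ?n"
        using bn sM(2) by (intro mult_strict_right_mono) auto
      ultimately have "fact ?n * b ^ ?n * (s * M) ^ ?n < a x * f (- u x)"
        by (simp add: mult.assoc)
      then have "lam ^ ?n * (fact ?n * b ^ ?n * (s * M) ^ ?n) < lam ^ ?n * (a x * f (- u x))"
        using lam0 by (intro mult_strict_left_mono) auto
      moreover have "x \<in> \<Omega>"
        using x r\<Omega> by auto
      ultimately show ?thesis
        by (simp add: eq k_def power_mult_distrib mult_ac)
    qed
    have "cball 0 r \<subseteq> closure \<Omega>"
      using r\<Omega> closure_subset[of \<Omega>] by blast
    then have "continuous_on (cball 0 r) (\<lambda>x. u x - k / 2 * (norm x)\<^sup>2)"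
      by (intro continuous_intros continuous_on_subset[OF cont])
    moreover have "cball 0 r \<noteq> ({} :: (real ^ 'n) set)"
      using r(1) by simp
    ultimately obtain z where z: "z \<in> cball 0 r"
      "\<And>x. x \<in> cball 0 r \<Longrightarrow> u x - k / 2 * (norm x)\<^sup>2 \<le> u z - k / 2 * (norm z)\<^sup>2"
      using continuous_attains_sup[OF compact_cball, of 0 r "\<lambda>x. u x - k / 2 * (norm x)\<^sup>2"] by blast
    have "z \<notin> ball 0 r"
    proof
      assume zb: "z \<in> ball 0 r"
      have z\<Omega>: "z \<in> \<Omega>"
        using z(1) r\<Omega> by auto
      have sub: "ball 0 r \<subseteq> \<Omega>"
        using r\<Omega> ball_subset_cball by blast
      \<comment> \<open>A maximum is contact from above, that is
        \<open>hessian_ge_at_contact\<close> with sign -1 and opening \<open>- k\<close>.\<close>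
      have "(- 1) * u z - (- k) / 2 * (norm z)\<^sup>2 \<le> (- 1) * u x - (- k) / 2 * (norm x)\<^sup>2"
        if "x \<in> ball 0 r" for x
        using z(2)[of x] that by simp
      then have "(- k) * (norm h)\<^sup>2 \<le> (- 1) * (h \<bullet> (hessian u z *v h))" for h
        by (intro hessian_ge_at_contact[OF u open_ball sub assms(1) zb])
      then have "\<bar>det (hessian u z)\<bar> \<le> fact ?n * k ^ ?n"
        using hessian_symmetric[OF u assms(1) z\<Omega>] convex_imp_hessian_nonneg[OF u assms(1) z\<Omega> conv]
        by (intro abs_det_le_of_quadratic_form) auto
      with det_gt[OF z(1)] show False
        by simp
    qed
    then have "norm z = r"
      using z(1) by auto
    moreover have "u z \<le> 0"
      using y(4) z(1) r\<Omega> by auto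
    moreover have "u 0 \<le> u z - k / 2 * (norm z)\<^sup>2"
      using z(2)[of 0] r(1) by simp
    moreover have "- M \<le> u 0"
      using y(3)[of 0] assms(3) closure_subset[of \<Omega>] by (auto simp: M_def)
    \<comment> \<open>On the sphere the facts combine to
      \<open>- M \<le> u 0 \<le> - k r^2 / 2\<close>.\<close>
    ultimately have "M * (lam * (b * s * r\<^sup>2)) \<le> M * 2"
      by (simp add: k_def mult_ac)
    then have "lam * (b * s * r\<^sup>2) \<le> 2"
      using M by (simp only: mult_le_cancel_left_pos)
    moreover have "2 < lam * (b * s * r\<^sup>2)"
      using lam b s r by (simp add: pos_divide_less_eq)
    ultimately show False
      by simp
  qed
  then show thesis
    using that[of "2 / (b * s * r\<^sup>2)"] b s r by fastforce
qed

text \<open>The seven cases reduce to two: finite limits exclude small \<open>lam\<close>, positive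
  limits exclude large \<open>lam\<close>. In case (a) both apply; (b), (d), (e) use the first and
  (c), (f), (g) the second.\<close>

theorem theorem7p2:
  fixes \<Omega> :: "(real ^ 'n::finite) set"
    and a :: "real ^ 'n \<Rightarrow> real"
    and f :: "real \<Rightarrow> real"
    and f0 finf :: ereal
  assumes "open \<Omega>" and "bounded \<Omega>" and "convex \<Omega>" and "smooth_boundary \<Omega>"
    and "0 \<in> interior \<Omega>"
    and "Ck_on_closure 2 \<Omega> a"
    and "\<forall>x\<in>closure \<Omega>. a x \<ge> 0"
    and "\<forall>x\<in>\<Omega>. a x > 0"
    and "C2_on_halfline f"
    and "mono_on {0..} f"
    and "\<forall>s\<ge>0. f s \<ge> 0"
    and "\<forall>s>0. f s > 0"
    and "((\<lambda>s. ereal (f s / s ^ CARD('n))) \<longlongrightarrow> f0) (at_right 0)"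
    and "((\<lambda>s. ereal (f s / s ^ CARD('n))) \<longlongrightarrow> finf) at_top"
  shows
    "(f0 \<in> {0<..<\<infinity>} \<and> finf \<in> {0<..<\<infinity>} \<longrightarrow>
        (\<exists>\<mu>\<^sub>2>0. \<exists>\<mu>\<^sub>3>0. \<forall>lam\<in>{0<..<\<mu>\<^sub>2} \<union> {\<mu>\<^sub>3<..}. \<nexists>u. convex_solution \<Omega> a f lam u)) \<and>
     (f0 \<in> {0<..<\<infinity>} \<and> finf = 0 \<longrightarrow>
        (\<exists>\<mu>\<^sub>4>0. \<forall>lam\<in>{0<..<\<mu>\<^sub>4}. \<nexists>u. convex_solution \<Omega> a f lam u)) \<and>
     (f0 \<in> {0<..<\<infinity>} \<and> finf = \<infinity> \<longrightarrow>
        (\<exists>\<mu>\<^sub>5>0. \<forall>lam\<in>{\<mu>\<^sub>5<..}. \<nexists>u. convex_solution \<Omega> a f lam u)) \<and>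
     (f0 = 0 \<and> finf \<in> {0<..<\<infinity>} \<longrightarrow>
        (\<exists>\<mu>\<^sub>6>0. \<forall>lam\<in>{0<..<\<mu>\<^sub>6}. \<nexists>u. convex_solution \<Omega> a f lam u)) \<and>
     (f0 = 0 \<and> finf = 0 \<longrightarrow>
        (\<exists>\<mu>\<^sub>7>0. \<forall>lam\<in>{0<..<\<mu>\<^sub>7}. \<nexists>u. convex_solution \<Omega> a f lam u)) \<and>
     (f0 = \<infinity> \<and> finf \<in> {0<..<\<infinity>} \<longrightarrow>
        (\<exists>\<mu>\<^sub>8>0. \<forall>lam\<in>{\<mu>\<^sub>8<..}. \<nexists>u. convex_solution \<Omega> a f lam u)) \<and>
     (f0 = \<infinity> \<and> finf = \<infinity> \<longrightarrow>
        (\<exists>\<mu>\<^sub>9>0. \<forall>lam\<in>{\<mu>\<^sub>9<..}. \<nexists>u. convex_solution \<Omega> a f lam u))"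
proof -
  have \<Omega>: "0 \<in> \<Omega>"
    using assms(5) interior_subset by auto
  have a: "continuous_on (closure \<Omega>) a"
    using assms(6) by (simp add: Ck_on_closure_def)
  have small: "\<exists>\<mu>>0. \<forall>lam\<in>{0<..<\<mu>}. \<nexists>u. convex_solution \<Omega> a f lam u" if fin: "f0 \<noteq> \<infinity>" "finf \<noteq> \<infinity>"
  proof -
    obtain C where C: "C > 0" "\<And>s. s > 0 \<Longrightarrow> f s \<le> C * s ^ CARD('n)"
      using power_growth_upper[OF assms(10) _ assms(13,14) fin] assms(11) by blast
    show ?thesis
      using no_convex_solution_small[OF assms(1,2) a _ assms(10) _ C] assms(7,11)
      by (metis greaterThanLessThan_iff)
  qed
  have large: "\<exists>\<mu>>0. \<forall>lam\<in>{\<mu><..}. \<nexists>u. convex_solution \<Omega> a f lam u" if pos: "f0 > 0" "finf > 0"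
  proof -
    obtain c where c: "c > 0" "\<And>s. s > 0 \<Longrightarrow> c * s ^ CARD('n) \<le> f s"
      using power_growth_lower[OF assms(10) _ assms(13,14) pos] assms(12) by blast
    show ?thesis
      using no_convex_solution_large[OF assms(1,2) \<Omega> a _ c] assms(8)
      by (metis greaterThan_iff)
  qed
  have both: "\<exists>\<mu>\<^sub>2>0. \<exists>\<mu>\<^sub>3>0. \<forall>lam\<in>{0<..<\<mu>\<^sub>2} \<union> {\<mu>\<^sub>3<..}. \<nexists>u. convex_solution \<Omega> a f lam u"
    if "f0 \<in> {0<..<\<infinity>}" "finf \<in> {0<..<\<infinity>}"
  proof -
    have "f0 \<noteq> \<infinity>" "finf \<noteq> \<infinity>" "f0 > 0" "finf > 0"
      using that by auto
    with small large show ?thesis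
      by (metis UnE)
  qed
  show ?thesis
    by (intro conjI impI; (rule both | rule small | rule large); auto)
qed

end
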